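(* Let $u:\mathbb{T}^m\times\mathbb{R}^n\to\mathbb{C}$ be such that there exist $C,N>0$ such that $$|u(t,\xi)|\leq C(1+|\xi|^2)^{N/2}$$ for each $(t,\xi)\in\mathbb{T}^m\times\mathbb{R}^n$. Then there exists a unique $\check{u}\in\mathcal{S}'(\mathbb{T}^m\times\mathbb{R}^n)$ given by $$\langle\check{u},f\rangle=\frac{1}{(2\pi)^n}\int_{\mathbb{T}^m}\int_{\mathbb{R}^n}\int_{\mathbb{R}^n}u(t,\xi)e^{ix\cdot\xi}f(t,x)\,d\xi\,dx\,dt=\frac{1}{(2\pi)^n}\int_{\mathbb{T}^m}\int_{\mathbb{R}^n}u(t,\xi)\widehat{f}(t,-\xi)\,d\xi\,dt$$ for each $f\in\mathcal{S}(\mathbb{T}^m\times\mathbb{R}^n)$, and we define $\mathcal{F}_{\mathbb{R}^n}^{-1}(u):=\check{u}$.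
   Context: Here $m,n\in\mathbb{N}$ and $\mathbb{T}^m=(\mathbb{R}/2\pi\mathbb{Z})^m$, with variables $(t,x)\in\mathbb{T}^m\times\mathbb{R}^n$; $\mathbb{N}_0$ denotes the nonnegative integers. $\mathcal{S}(\mathbb{T}^m\times\mathbb{R}^n)$ is the Fréchet space of all $f\in C^\infty(\mathbb{T}^m\times\mathbb{R}^n)$ such that $\|f\|_{\alpha,\beta,\gamma}:=\sup_{(t,x)\in\mathbb{T}^m\times\mathbb{R}^n}|x^\gamma\partial_t^\alpha\partial_x^\beta f(t,x)|<+\infty$ for all $\alpha\in\mathbb{N}_0^m$, $\beta,\gamma\in\mathbb{N}_0^n$, with topology induced by the seminorms $p_M(f):=\sum_{|\alpha|+|\beta|+|\gamma|\leq M}\|f\|_{\alpha,\beta,\gamma}$, $M\in\mathbb{N}_0$. $\mathcal{S}'(\mathbb{T}^m\times\mathbb{R}^n)$ is its dual space, that is, the space of all linear functionals $v:\mathcal{S}(\mathbb{T}^m\times\mathbb{R}^n)\to\mathbb{C}$ for which there exist $M,K>0$ with $|\langle v,f\rangle|\leq K p_M(f)$ for every $f\in\mathcal{S}(\mathbb{T}^m\times\mathbb{R}^n)$. For $f\in\mathcal{S}(\mathbb{T}^m\times\mathbb{R}^n)$, the partial Fourier transform is $\widehat{f}(t,\xi):=\int_{\mathbb{R}^n}f(t,x)e^{-ix\cdot\xi}\,dx$.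
   Formalization: u is assumed Lebesgue measurable (otherwise the integrals are undefined), and the triple integral is taken with x innermost, then ξ, then t, since the ξ-integral of u(t,ξ)e^{ix·ξ} diverges in general (e.g. u = 1). *)

theory Defs
  imports "HOL-Analysis.Analysis"
begin

subsection \<open>The torus\<close>

definition circle_rel :: "real \<Rightarrow> real \<Rightarrow> bool" where
  "circle_rel s t \<longleftrightarrow> (\<exists>k::int. s - t = 2 * pi * of_int k)"

lemma equivp_circle_rel: "equivp circle_rel"
proof (rule equivpI)
  show "reflp circle_rel"
    by (auto simp: reflp_def circle_rel_def intro: exI[of _ 0])
  show "symp circle_rel"
  proof (rule sympI)
    fix s t assume "circle_rel s t"
    then obtain k :: int where "s - t = 2 * pi * of_int k"
      by (auto simp: circle_rel_def)
    then have "t - s = 2 * pi * of_int (- k)" by simp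
    then show "circle_rel t s" unfolding circle_rel_def by blast
  qed
  show "transp circle_rel"
  proof (rule transpI)
    fix r s t assume "circle_rel r s" "circle_rel s t"
    then obtain k l :: int where "r - s = 2 * pi * of_int k" "s - t = 2 * pi * of_int l"
      by (auto simp: circle_rel_def)
    then have "r - t = 2 * pi * of_int (k + l)" by (simp add: algebra_simps)
    then show "circle_rel r t" unfolding circle_rel_def by blast
  qed
qed

quotient_type circle = real / circle_rel
  by (rule equivp_circle_rel)

type_synonym 'm torus = "circle ^ 'm"

definition to_torus :: "real ^ 'm::finite \<Rightarrow> 'm torus" where
  "to_torus t = (\<chi> i. abs_circle (t $ i))"

text \<open>
  Smoothness, derivatives and measurability on the product of the torus with Euclidean space
  are those of the periodic lift to \<open>(real ^ 'm) \<times> (real ^ 'n)\<close>. The torus carries the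
  unnormalised measure \<open>dt\<close>, of total mass \<open>(2 * pi) ^ CARD('m)\<close>.
\<close>

definition lift_torus :: "('m::finite torus \<times> (real ^ 'n::finite) \<Rightarrow> complex) \<Rightarrow> ((real ^ 'm) \<times> (real ^ 'n) \<Rightarrow> complex)" where
  "lift_torus f = (\<lambda>(t, x). f (to_torus t, x))"

definition fundamental_cube :: "(real ^ 'm) set" where
  "fundamental_cube = cbox 0 (\<chi> i. 2 * pi)"

definition torus_integral :: "('m::finite torus \<Rightarrow> complex) \<Rightarrow> complex" where
  "torus_integral g = (LINT t:fundamental_cube|lebesgue. g (to_torus t))"

subsection \<open>Smooth functions and multi-index derivatives\<close>

definition partial_deriv :: "'a \<Rightarrow> ('a::euclidean_space \<Rightarrow> complex) \<Rightarrow> ('a \<Rightarrow> complex)" where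
  "partial_deriv e f = (\<lambda>z. frechet_derivative f (at z) e)"

primrec k_times_cont_diff :: "nat \<Rightarrow> ('a::euclidean_space \<Rightarrow> complex) \<Rightarrow> bool" where
  "k_times_cont_diff 0 f \<longleftrightarrow> continuous_on UNIV f"
| "k_times_cont_diff (Suc k) f \<longleftrightarrow>
     (\<forall>z. f differentiable (at z)) \<and> (\<forall>e\<in>Basis. k_times_cont_diff k (partial_deriv e f))"

definition smooth :: "('a::euclidean_space \<Rightarrow> complex) \<Rightarrow> bool" where
  "smooth f \<longleftrightarrow> (\<forall>k. k_times_cont_diff k f)"

type_synonym 'k multi_index = "'k \<Rightarrow> nat"

definition index_order :: "'k::finite multi_index \<Rightarrow> nat" where
  "index_order \<alpha> = (\<Sum>i\<in>UNIV. \<alpha> i)"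

text \<open>
  A multi-index \<open>\<alpha>\<close> is spelled out as a list of coordinates in which every \<open>i\<close> occurs exactly
  \<open>\<alpha> i\<close> times. The index type is unordered, so the order of the list is an arbitrary choice; it
  is immaterial for the derivatives of smooth functions, because their partial derivatives
  commute.
\<close>

definition index_list :: "'k::finite multi_index \<Rightarrow> 'k list" where
  "index_list \<alpha> = (SOME is. \<forall>i. count_list is i = \<alpha> i)"

lemma count_index_list: "count_list (index_list \<alpha>) i = \<alpha> i"
proof -
  obtain "is" where "mset is = Abs_multiset \<alpha>"
    using ex_mset by blast
  moreover have "count (Abs_multiset \<alpha>) = \<alpha>"
    by (simp add: Abs_multiset_inverse)
  ultimately have "\<forall>i. count_list is i = \<alpha> i"
    by (metis count_mset)
  then have "\<forall>i. count_list (index_list \<alpha>) i = \<alpha> i"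
    unfolding index_list_def by (rule someI)
  then show ?thesis ..
qed

definition multi_deriv ::
  "'m::finite multi_index \<Rightarrow> 'n::finite multi_index \<Rightarrow>
   ((real ^ 'm) \<times> (real ^ 'n) \<Rightarrow> complex) \<Rightarrow> ((real ^ 'm) \<times> (real ^ 'n) \<Rightarrow> complex)" where
  "multi_deriv \<alpha> \<beta> g =
     foldr partial_deriv
       (map (\<lambda>i. (axis i 1, 0)) (index_list \<alpha>) @ map (\<lambda>j. (0, axis j 1)) (index_list \<beta>)) g"

definition monomial :: "'n::finite multi_index \<Rightarrow> real ^ 'n \<Rightarrow> real" where
  "monomial \<gamma> x = (\<Prod>j\<in>UNIV. (x $ j) ^ \<gamma> j)"

subsection \<open>The Schwartz space and its dual\<close>

definition weighted_deriv ::
  "'m::finite multi_index \<Rightarrow> 'n::finite multi_index \<Rightarrow> 'n multi_index \<Rightarrow>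
   ('m torus \<times> (real ^ 'n) \<Rightarrow> complex) \<Rightarrow> (real ^ 'm) \<times> (real ^ 'n) \<Rightarrow> real" where
  "weighted_deriv \<alpha> \<beta> \<gamma> f z =
     norm (of_real (monomial \<gamma> (snd z)) * multi_deriv \<alpha> \<beta> (lift_torus f) z)"

definition schwartz :: "('m::finite torus \<times> (real ^ 'n::finite) \<Rightarrow> complex) set" where
  "schwartz = {f. smooth (lift_torus f) \<and> (\<forall>\<alpha> \<beta> \<gamma>. bdd_above (range (weighted_deriv \<alpha> \<beta> \<gamma> f)))}"

definition schwartz_norm ::
  "'m::finite multi_index \<Rightarrow> 'n::finite multi_index \<Rightarrow> 'n multi_index \<Rightarrow>
   ('m torus \<times> (real ^ 'n) \<Rightarrow> complex) \<Rightarrow> real" where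
  "schwartz_norm \<alpha> \<beta> \<gamma> f = (SUP z. weighted_deriv \<alpha> \<beta> \<gamma> f z)"

definition schwartz_seminorm ::
  "nat \<Rightarrow> ('m::finite torus \<times> (real ^ 'n::finite) \<Rightarrow> complex) \<Rightarrow> real" where
  "schwartz_seminorm M f =
     (\<Sum>(\<alpha>, \<beta>, \<gamma>) \<in> {(\<alpha>, \<beta>, \<gamma>). index_order \<alpha> + index_order \<beta> + index_order \<gamma> \<le> M}.
        schwartz_norm \<alpha> \<beta> \<gamma> f)"

lemma finite_index_order_le: "finite {\<alpha> :: 'k::finite multi_index. index_order \<alpha> \<le> M}"
proof (rule finite_subset)
  show "{\<alpha> :: 'k multi_index. index_order \<alpha> \<le> M} \<subseteq> (UNIV :: 'k set) \<rightarrow>\<^sub>E {..M}"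
  proof
    fix \<alpha> :: "'k multi_index" assume "\<alpha> \<in> {\<alpha>. index_order \<alpha> \<le> M}"
    moreover have "\<alpha> i \<le> index_order \<alpha>" for i
      unfolding index_order_def by (rule member_le_sum) auto
    ultimately show "\<alpha> \<in> UNIV \<rightarrow>\<^sub>E {..M}"
      by (auto intro: order_trans)
  qed
  show "finite ((UNIV :: 'k set) \<rightarrow>\<^sub>E {..M})"
    by (intro finite_PiE) auto
qed

lemma finite_schwartz_seminorm_indices:
  "finite {(\<alpha> :: 'm::finite multi_index, \<beta> :: 'n::finite multi_index, \<gamma> :: 'n multi_index).
     index_order \<alpha> + index_order \<beta> + index_order \<gamma> \<le> M}"
proof (rule finite_subset)
  show "finite ({\<alpha> :: 'm multi_index. index_order \<alpha> \<le> M} \<times>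
      {\<beta> :: 'n multi_index. index_order \<beta> \<le> M} \<times> {\<gamma> :: 'n multi_index. index_order \<gamma> \<le> M})"
    by (intro finite_cartesian_product finite_index_order_le)
qed auto

text \<open>
  A functional on the Schwartz space is a HOL function that is \<open>undefined\<close> off the space
  (\<open>extensional\<close>), so that equality of functionals is equality on the Schwartz space.
\<close>

definition schwartz_dual ::
  "(('m::finite torus \<times> (real ^ 'n::finite) \<Rightarrow> complex) \<Rightarrow> complex) set" where
  "schwartz_dual = {v \<in> extensional schwartz.
     (\<forall>f\<in>schwartz. \<forall>g\<in>schwartz. v (\<lambda>z. f z + g z) = v f + v g) \<and>
     (\<forall>c. \<forall>f\<in>schwartz. v (\<lambda>z. c * f z) = c * v f) \<and>
     (\<exists>M::nat. \<exists>K::real. M > 0 \<and> K > 0 \<and>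
        (\<forall>f\<in>schwartz. norm (v f) \<le> K * schwartz_seminorm M f))}"

subsection \<open>The partial Fourier transform and its inverse\<close>

definition partial_fourier ::
  "('m::finite torus \<times> (real ^ 'n::finite) \<Rightarrow> complex) \<Rightarrow> ('m torus \<times> (real ^ 'n) \<Rightarrow> complex)" where
  "partial_fourier f = (\<lambda>(t, \<xi>). LINT x|lebesgue. f (t, x) * exp (- \<i> * of_real (x \<bullet> \<xi>)))"

text \<open>
  In the triple integral the integration over \<open>x\<close> is innermost: for \<open>u\<close> of polynomial growth
  the integral of \<open>u (t, \<xi>) * exp (\<i> * (x \<bullet> \<xi>))\<close> over \<open>\<xi>\<close> diverges in general, already
  for constant \<open>u\<close>.
\<close>

definition inverse_partial_fourier ::
  "('m::finite torus \<times> (real ^ 'n::finite) \<Rightarrow> complex) \<Rightarrow>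
   ('m torus \<times> (real ^ 'n) \<Rightarrow> complex) \<Rightarrow> complex" where
  "inverse_partial_fourier u = (THE v. v \<in> schwartz_dual \<and>
     (\<forall>f\<in>schwartz.
        v f = 1 / (2 * of_real pi) ^ CARD('n) *
          torus_integral (\<lambda>t. LINT \<xi>|lebesgue. LINT x|lebesgue.
            u (t, \<xi>) * exp (\<i> * of_real (x \<bullet> \<xi>)) * f (t, x)) \<and>
        v f = 1 / (2 * of_real pi) ^ CARD('n) *
          torus_integral (\<lambda>t. LINT \<xi>|lebesgue. u (t, \<xi>) * partial_fourier f (t, - \<xi>))))"

end

theory Submission imports Defs begin

text \<open>
  Up to the factor \<open>1 / (2 * pi) ^ CARD('n)\<close>, the functional is the single integral of \<open>u (t, \<xi>) * partial_fourier f (t, - \<xi>)\<close> over the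
  fundamental cube times Euclidean space, and everything rests on one estimate: for every
  exponent \<open>r\<close>, the product of \<open>(1 + |\<xi>|\<^sup>2)\<^sup>r\<close> and the partial Fourier transform of \<open>f\<close> is
  bounded by a Schwartz seminorm of \<open>f\<close> times a fixed integrable function of \<open>\<xi>\<close>
  (\<open>fourier_slice_decay\<close>). With \<open>r = N / 2\<close> this absorbs the polynomial growth of \<open>u\<close>; it gives
  absolute convergence and, after integration, continuity.

  The integrable majorant is the product \<open>decay_weight\<close> of the functions \<open>1 / (1 + x\<^sub>j\<^sup>2)\<close>. Expanding
  the reciprocal of this product into monomials shows that each derivative of a Schwartz function
  is at most a seminorm times the weight (\<open>schwartz_decay\<close>), so all integrals over \<open>x\<close> converge.
  Multiplication of the Fourier integral by \<open>\<xi>\<^sub>j\<close> corresponds to a derivative in \<open>x\<^sub>j\<close>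
  (\<open>fourier_slice_partial_deriv\<close>). The powers of the individual coordinates control the full polynomial
  weight (\<open>power_one_plus_sum_le\<close>), so that repeated derivatives in one direction are enough and
  mixed derivatives never have to be reordered.

  Two more points are needed. The iterated integrals of the statement are integrals with respect
  to Lebesgue measure of a function that is only Lebesgue measurable on the product, so that its
  sections are measurable for almost every \<open>t\<close> only; a version of Fubini's theorem for the
  completed measure (\<open>lebesgue_Fubini\<close>) rewrites them as one integral over the product, which is
  visibly linear in \<open>f\<close>. Uniqueness holds because functionals are determined by their values on the
  Schwartz space.
\<close>

section \<open>An integrable weight\<close>

definition decay_weight :: "real ^ 'n::finite \<Rightarrow> real" where
  "decay_weight x = (\<Prod>j\<in>UNIV. 1 / (1 + (x $ j)\<^sup>2))"

lemma decay_weight_pos: "decay_weight x > 0"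
  unfolding decay_weight_def by (intro prod_pos) (auto simp: add_pos_nonneg)

lemma borel_measurable_decay_weight [measurable]: "decay_weight \<in> borel_measurable borel"
proof -
  have "continuous_on UNIV (decay_weight :: real ^ 'n \<Rightarrow> real)"
    unfolding decay_weight_def
    by (intro continuous_intros) (metis add_pos_nonneg less_numeral_extra(1,3) zero_le_power2)
  then show ?thesis
    by (rule borel_measurable_continuous_onI)
qed

text \<open>
  The primitive \<open>arctan\<close> gives the integral over the positive half-line, and reflection the
  other half.
\<close>

lemma nn_integral_Cauchy_density_finite:
  "(\<integral>\<^sup>+x. ennreal (1 / (1 + x\<^sup>2)) \<partial>lborel) < \<infinity>" (is "?I < _")
proof -
  let ?q = "\<lambda>x::real. ennreal (1 / (1 + x\<^sup>2))"
  have half: "(\<integral>\<^sup>+x. ?q x * indicator {0..} x \<partial>lborel) = ennreal (pi / 2)"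
  proof -
    have "(arctan has_real_derivative 1 / (1 + x\<^sup>2)) (at x)" for x :: real
      using DERIV_arctan[of x] by (simp add: inverse_eq_divide)
    then show ?thesis
      using nn_integral_FTC_atLeast[of "\<lambda>x. 1 / (1 + x\<^sup>2)" 0 arctan "pi / 2"]
      by (simp add: tendsto_arctan_at_top add_nonneg_nonneg)
  qed
  have "(\<integral>\<^sup>+x. ?q x * indicator {..0} x \<partial>lborel) =
      (\<integral>\<^sup>+x. ?q x * indicator {0..} x \<partial>lborel)"
    by (subst nn_integral_real_affine[where c = "-1" and t = 0])
       (auto intro!: nn_integral_cong split: split_indicator)
  moreover have "?I \<le> (\<integral>\<^sup>+x. ?q x * indicator {0..} x + ?q x * indicator {..0} x \<partial>lborel)"
    by (intro nn_integral_mono) (auto split: split_indicator)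
  moreover have "\<dots> = (\<integral>\<^sup>+x. ?q x * indicator {0..} x \<partial>lborel) +
      (\<integral>\<^sup>+x. ?q x * indicator {..0} x \<partial>lborel)"
    by (intro nn_integral_add) auto
  ultimately have "?I \<le> ennreal (pi / 2) + ennreal (pi / 2)"
    using half by simp
  also have "\<dots> < \<infinity>"
    by simp
  finally show ?thesis .
qed

lemma bij_betw_axis_Basis: "bij_betw (\<lambda>j. axis j 1) UNIV (Basis :: (real ^ 'n::finite) set)"
  by (auto simp: bij_betw_def inj_on_def axis_eq_axis Basis_vec_def)

lemma integrable_decay_weight: "integrable lborel (decay_weight :: real ^ 'n::finite \<Rightarrow> real)"
proof (rule integrableI_nonneg)
  have "(\<integral>\<^sup>+x. ennreal (decay_weight (x :: real ^ 'n)) \<partial>lborel) =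
      (\<integral>\<^sup>+x. (\<Prod>b\<in>Basis. ennreal (1 / (1 + (x \<bullet> b)\<^sup>2))) \<partial>(lborel :: (real ^ 'n) measure))"
    unfolding decay_weight_def
    by (intro nn_integral_cong, subst prod_ennreal[symmetric])
       (auto simp: add_nonneg_nonneg inner_axis
          prod.reindex_bij_betw[OF bij_betw_axis_Basis, symmetric])
  also have "\<dots> = (\<Prod>b\<in>(Basis :: (real ^ 'n) set). \<integral>\<^sup>+x. ennreal (1 / (1 + x\<^sup>2)) \<partial>lborel)"
    by (rule nn_integral_lborel_prod) auto
  also have "\<dots> < \<infinity>"
    using nn_integral_Cauchy_density_finite by (simp add: power_less_top_ennreal)
  finally show "(\<integral>\<^sup>+x. ennreal (decay_weight (x :: real ^ 'n)) \<partial>lborel) < \<infinity>" .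
qed (auto intro: less_imp_le decay_weight_pos)

text \<open>
  Makes the weight usable as a majorant for difference quotients, which involve points near \<open>x\<close>.
\<close>

lemma decay_weight_translate:
  fixes x y :: "real ^ 'n::finite"
  assumes "norm y \<le> 1"
  shows "decay_weight (x + y) \<le> 3 ^ CARD('n) * decay_weight x"
proof -
  have "1 / (1 + (x $ j + y $ j)\<^sup>2) \<le> 3 * (1 / (1 + (x $ j)\<^sup>2))" for j
  proof -
    have "(y $ j)\<^sup>2 \<le> 1"
      using component_le_norm_cart[of y j] assms by (simp add: abs_square_le_1)
    moreover have "(x $ j)\<^sup>2 \<le> 2 * (x $ j + y $ j)\<^sup>2 + 2 * (y $ j)\<^sup>2"
      using zero_le_power2[of "x $ j + 2 * y $ j"] by (simp add: power2_eq_square algebra_simps)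
    ultimately have "1 + (x $ j)\<^sup>2 \<le> 3 * (1 + (x $ j + y $ j)\<^sup>2)"
      by (smt (verit) zero_le_power2)
    moreover have "1 + (x $ j)\<^sup>2 > 0" "1 + (x $ j + y $ j)\<^sup>2 > 0"
      by (auto simp: add_pos_nonneg)
    ultimately show ?thesis
      by (simp add: divide_simps mult.commute)
  qed
  then have "decay_weight (x + y) \<le> (\<Prod>j\<in>(UNIV::'n set). 3 * (1 / (1 + (x $ j)\<^sup>2)))"
    unfolding decay_weight_def by (intro prod_mono) (auto simp: add_nonneg_nonneg)
  then show ?thesis
    by (simp add: prod.distrib decay_weight_def del: times_divide_eq_right)
qed

section \<open>The integral of a directional derivative\<close>

text \<open>
  By translation invariance of Lebesgue measure, every difference quotient of \<open>F\<close> in the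
  direction \<open>e\<close> has integral zero. By the mean value inequality the quotients with steps at most 1
  are dominated by a multiple of the weight, so the integral passes to the limit. This replaces the
  one-dimensional fundamental theorem of calculus and Fubini's theorem in integration by parts.
\<close>

lemma integral_directional_derivative_eq_0:
  fixes F :: "real ^ 'n::finite \<Rightarrow> complex"
  assumes der: "\<And>x. (F has_derivative F' x) (at x)"
    and int: "integrable lborel F"
    and bound: "\<And>x. norm (F' x e) \<le> B * decay_weight x"
    and e: "norm e \<le> 1"
  shows "(LINT x|lborel. F' x e) = 0"
proof -
  have F_cont: "continuous_on UNIV F"
    using der by (meson continuous_at_imp_continuous_on has_derivative_continuous)
  then have F_meas [measurable]: "F \<in> borel_measurable borel"
    by (rule borel_measurable_continuous_onI)
  have line: "((\<lambda>r. F (x + r *\<^sub>R e)) has_vector_derivative F' (x + r *\<^sub>R e) e) (at r)" for x r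
  proof -
    have "(F \<circ> (\<lambda>r. x + r *\<^sub>R e) has_derivative F' (x + r *\<^sub>R e) \<circ> (\<lambda>h. h *\<^sub>R e)) (at r)"
      by (rule diff_chain_at[OF _ der]) (auto intro!: derivative_eq_intros)
    moreover have "F' (x + r *\<^sub>R e) \<circ> (\<lambda>h. h *\<^sub>R e) = (\<lambda>h. h *\<^sub>R F' (x + r *\<^sub>R e) e)"
      using has_derivative_linear[OF der] by (auto simp: linear_scale)
    ultimately show ?thesis
      by (simp add: has_vector_derivative_def o_def)
  qed
  define h :: "nat \<Rightarrow> real" where "h i = inverse (real (Suc i))" for i
  have h: "0 < h i" "h i \<le> 1" for i
    unfolding h_def by (auto simp: field_simps)
  define Q where "Q i x = (F (x + h i *\<^sub>R e) - F x) /\<^sub>R h i" for i x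
  have shift: "integrable lborel (\<lambda>x. F (x + y))"
      "(LINT x|lborel. F (x + y)) = (LINT x|lborel. F x)" for y
    using int integrable_distr_eq[of "(+) y" lborel borel F] integral_distr[of "(+) y" lborel borel F]
    by (simp_all add: lborel_distr_plus add.commute[of y])
  have Q_int: "(LINT x|lborel. Q i x) = 0" for i
  proof -
    have "(LINT x|lborel. Q i x) =
        ((LINT x|lborel. F (x + h i *\<^sub>R e)) - (LINT x|lborel. F x)) /\<^sub>R h i"
      unfolding Q_def integral_scaleR_right
      by (simp only: Bochner_Integration.integral_diff[OF shift(1) int])
    then show ?thesis
      by (simp only: shift(2) diff_self scaleR_zero_right)
  qed
  have "(\<lambda>i. LINT x|lborel. Q i x) \<longlonglongrightarrow> (LINT x|lborel. F' x e)"
  proof (rule integral_dominated_convergence)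
    have Q_lim: "(\<lambda>i. Q i x) \<longlonglongrightarrow> F' x e" for x
    proof -
      have "((\<lambda>r. (F (x + r *\<^sub>R e) - F x) /\<^sub>R r) \<longlongrightarrow> F' x e) (at 0)"
      proof -
        have "(\<lambda>r. norm (F (x + r *\<^sub>R e) - F x - r *\<^sub>R F' x e) / norm r) \<midarrow>0\<rightarrow> 0"
          using line[of x 0] by (simp add: has_vector_derivative_def has_derivative_at)
        then have "(\<lambda>r. norm ((F (x + r *\<^sub>R e) - F x) /\<^sub>R r - F' x e)) \<midarrow>0\<rightarrow> 0"
        proof (rule Lim_transform_eventually)
          have "norm (F (x + r *\<^sub>R e) - F x - r *\<^sub>R F' x e) / norm r =
              norm ((F (x + r *\<^sub>R e) - F x) /\<^sub>R r - F' x e)" if "r \<noteq> 0" for r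
          proof -
            have "(F (x + r *\<^sub>R e) - F x) /\<^sub>R r - F' x e =
                (F (x + r *\<^sub>R e) - F x - r *\<^sub>R F' x e) /\<^sub>R r"
              using that by (simp add: scaleR_diff_right)
            then show ?thesis
              by (simp add: divide_inverse mult.commute)
          qed
          then show "\<forall>\<^sub>F r in at 0. norm (F (x + r *\<^sub>R e) - F x - r *\<^sub>R F' x e) / norm r =
              norm ((F (x + r *\<^sub>R e) - F x) /\<^sub>R r - F' x e)"
            by (auto simp: eventually_at_filter)
        qed
        then show ?thesis
          by (rule LIM_zero_cancel[OF tendsto_norm_zero_cancel])
      qed
      moreover have "h \<longlonglongrightarrow> 0"
        unfolding h_def by (rule LIMSEQ_inverse_real_of_nat)
      then have "filterlim h (at 0) sequentially"
        by (simp add: filterlim_at order_less_imp_not_eq2[OF h(1)])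
      ultimately show ?thesis
        unfolding Q_def by (rule filterlim_compose)
    qed
    then show "AE x in lborel. (\<lambda>i. Q i x) \<longlonglongrightarrow> F' x e"
      by simp
    show Q_meas: "Q i \<in> borel_measurable lborel" for i
      unfolding Q_def by measurable
    show "(\<lambda>x. F' x e) \<in> borel_measurable lborel"
      by (rule borel_measurable_LIMSEQ_metric[OF Q_meas Q_lim])
    show "integrable lborel (\<lambda>x. B * 3 ^ CARD('n) * decay_weight (x :: real ^ 'n))"
      by (simp add: integrable_decay_weight)
    have "norm (Q i x) \<le> B * 3 ^ CARD('n) * decay_weight x" for i x
    proof -
      have B: "B \<ge> 0"
        using order_trans[OF norm_ge_zero bound[of x]] decay_weight_pos[of x]
        by (simp add: zero_le_mult_iff)
      have le: "norm (F' (x + r *\<^sub>R e) e) \<le> B * 3 ^ CARD('n) * decay_weight x"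
        if "0 \<le> r" "r \<le> h i" for r
      proof -
        have "norm (r *\<^sub>R e) \<le> 1"
          using that h[of i] e by (simp add: mult_le_one)
        then have "B * decay_weight (x + r *\<^sub>R e) \<le> B * (3 ^ CARD('n) * decay_weight x)"
          by (intro mult_left_mono decay_weight_translate B)
        then show ?thesis
          using bound[of "x + r *\<^sub>R e"] by (simp add: mult.assoc)
      qed
      have "norm (F (x + h i *\<^sub>R e) - F (x + 0 *\<^sub>R e)) \<le>
          (B * 3 ^ CARD('n) * decay_weight x) * norm (h i - 0)"
      proof (rule differentiable_bound[of "{0..h i}" _ "\<lambda>r k. k *\<^sub>R F' (x + r *\<^sub>R e) e"])
        show "((\<lambda>r. F (x + r *\<^sub>R e)) has_derivative (\<lambda>k. k *\<^sub>R F' (x + r *\<^sub>R e) e))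
            (at r within {0..h i})" for r
          using line has_vector_derivative_at_within has_vector_derivative_def by blast
        show "onorm (\<lambda>k. k *\<^sub>R F' (x + r *\<^sub>R e) e) \<le> B * 3 ^ CARD('n) * decay_weight x"
          if "r \<in> {0..h i}" for r
          using le[of r] that by (intro onorm_le) (auto simp: mult.commute mult_left_mono)
      qed (use h[of i] in auto)
      moreover have "norm (Q i x) = norm (F (x + h i *\<^sub>R e) - F x) / h i"
        using h(1)[of i] by (simp add: Q_def divide_inverse mult.commute)
      ultimately show ?thesis
        using h(1)[of i] by (simp add: pos_divide_le_eq)
    qed
    then show "AE x in lborel. norm (Q i x) \<le> B * 3 ^ CARD('n) * decay_weight x" for i
      by simp
  qed
  then show ?thesis
    by (simp add: Q_int LIMSEQ_const_iff)
qed

section \<open>Fubini for the completed measure\<close>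

lemma borel_representative:
  fixes h :: "'a::euclidean_space \<Rightarrow> complex"
  assumes "h \<in> borel_measurable lebesgue"
  obtains h' where "h' \<in> borel_measurable borel" "AE x in lborel. h x = h' x"
proof -
  have "(\<lambda>x. Re (h x)) \<in> borel_measurable lebesgue" "(\<lambda>x. Im (h x)) \<in> borel_measurable lebesgue"
    using assms by measurable
  then obtain r i where r: "r \<in> borel_measurable lborel" "AE x in lborel. Re (h x) = r x"
    and i: "i \<in> borel_measurable lborel" "AE x in lborel. Im (h x) = i x"
    using completion_ex_borel_measurable_real[of "\<lambda>x. Re (h x)" lborel]
      completion_ex_borel_measurable_real[of "\<lambda>x. Im (h x)" lborel] by blast
  have [measurable]: "r \<in> borel_measurable borel" "i \<in> borel_measurable borel"
    using r(1) i(1) by auto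
  show thesis
  proof
    show "(\<lambda>x. of_real (r x) + \<i> * of_real (i x)) \<in> borel_measurable borel"
      by measurable
    show "AE x in lborel. h x = of_real (r x) + \<i> * of_real (i x)"
      using r(2) i(2) by eventually_elim (simp add: complex_eq_iff)
  qed
qed

text \<open>
  By completeness of \<open>lebesgue\<close>, a function that differs from a Borel function on a null set only
  is itself measurable.
\<close>

lemma lebesgue_integral_cong_borel:
  fixes f g :: "'a::euclidean_space \<Rightarrow> complex"
  assumes g: "g \<in> borel_measurable borel" and eq: "AE x in lborel. f x = g x"
  shows "(LINT x|lebesgue. f x) = (LINT x|lborel. g x)"
proof -
  have ae: "AE x in lebesgue. g x = f x"
    using eq by (intro AE_completion) (auto elim: eventually_mono)
  have g': "g \<in> borel_measurable lebesgue"
    using g by (simp add: measurable_completion)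
  have "f \<in> borel_measurable lebesgue"
  proof (rule borel_measurableI)
    fix S :: "complex set" assume "open S"
    then have "g -` S \<inter> space lebesgue \<in> sets lebesgue"
      by (intro measurable_sets[OF g']) simp
    then show "f -` S \<inter> space lebesgue \<in> sets lebesgue"
      by (rule completion.in_sets_AE[rotated]) (use ae in \<open>auto elim: eventually_mono\<close>)
  qed
  then have "(LINT x|lebesgue. f x) = (LINT x|lebesgue. g x)"
    using ae g' by (intro integral_cong_AE) auto
  then show ?thesis
    using g by (simp add: integral_completion)
qed

text \<open>
  On the product, \<open>lebesgue\<close> is the completion of the product of the Borel-Lebesgue measures and
  not a product measure itself. A Borel representative of \<open>h\<close> agrees with \<open>h\<close> on almost every
  section, and the classical theorem applies to the representative.
\<close>

lemma lebesgue_Fubini: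
  fixes h :: "'a::euclidean_space \<times> 'b::euclidean_space \<Rightarrow> complex"
  assumes h: "integrable lebesgue h"
  shows "(LINT s|lebesgue. LINT y|lebesgue. h (s, y)) = (LINT z|lebesgue. h z)"
proof -
  obtain h' where h' [measurable]: "h' \<in> borel_measurable borel"
    and eq: "AE z in lborel. h z = h' z"
    using borel_representative[OF borel_measurable_integrable[OF h]] by blast
  have ae: "AE z in lebesgue. h z = h' z"
    using eq by (rule AE_completion)
  have "integrable lebesgue h'"
    using h ae by (subst integrable_cong_AE[symmetric, of h]) (auto simp: measurable_completion)
  then have int: "integrable (lborel \<Otimes>\<^sub>M lborel) h'"
    by (simp add: integrable_completion lborel_prod)
  have "AE s in lborel. AE y in lborel. h (s, y) = h' (s, y)"
    by (rule lborel_pair.AE_pair) (subst lborel_prod, rule eq)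
  then have "AE s in lborel. (LINT y|lebesgue. h (s, y)) = (LINT y|lborel. h' (s, y))"
    by eventually_elim (rule lebesgue_integral_cong_borel, auto)
  then have "(LINT s|lebesgue. LINT y|lebesgue. h (s, y)) = (LINT s|lborel. LINT y|lborel. h' (s, y))"
    using borel_measurable_integrable[OF lborel_pair.integrable_fst'[OF int]]
    by (intro lebesgue_integral_cong_borel) auto
  also have "\<dots> = (LINT z|lborel. h' z)"
    using lborel_pair.integral_fst'[OF int] by (simp add: lborel_prod)
  also have "\<dots> = (LINT z|lebesgue. h z)"
    by (rule lebesgue_integral_cong_borel[OF h' eq, symmetric])
  finally show ?thesis .
qed

section \<open>Linear combinations of smooth and Schwartz functions\<close>

lemma smooth_has_derivative:
  "smooth f \<Longrightarrow> (f has_derivative frechet_derivative f (at z)) (at z)"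
  unfolding smooth_def by (metis k_times_cont_diff.simps(2) frechet_derivative_works)

lemma smooth_continuous_on: "smooth f \<Longrightarrow> continuous_on UNIV f"
  unfolding smooth_def by (metis k_times_cont_diff.simps(1))

lemma smooth_partial_deriv: "smooth f \<Longrightarrow> e \<in> Basis \<Longrightarrow> smooth (partial_deriv e f)"
  unfolding smooth_def by (metis k_times_cont_diff.simps(2))

lemma partial_deriv_linear:
  assumes "\<And>z. f differentiable (at z)" "\<And>z. g differentiable (at z)"
  shows "partial_deriv e (\<lambda>z. a * f z + b * g z) =
    (\<lambda>z. a * partial_deriv e f z + b * partial_deriv e g z)"
proof
  fix z
  have "((\<lambda>z. a * f z + b * g z) has_derivative
      (\<lambda>h. a * frechet_derivative f (at z) h + b * frechet_derivative g (at z) h)) (at z)"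
    by (intro has_derivative_add has_derivative_mult_right)
       (use assms in \<open>auto simp: frechet_derivative_works\<close>)
  from frechet_derivative_at[OF this] show "partial_deriv e (\<lambda>z. a * f z + b * g z) z =
      a * partial_deriv e f z + b * partial_deriv e g z"
    by (simp add: partial_deriv_def fun_eq_iff)
qed

lemma smooth_linear:
  assumes "smooth f" "smooth g"
  shows "smooth (\<lambda>z. a * f z + b * g z)"
proof -
  have "k_times_cont_diff k (\<lambda>z. a * f z + b * g z)"
    if "k_times_cont_diff k f" "k_times_cont_diff k g" for k f and g :: "'a \<Rightarrow> complex"
    using that
  proof (induction k arbitrary: f g)
    case 0
    then show ?case by (auto intro!: continuous_intros)
  next
    case (Suc k)
    then have diff: "\<And>z. f differentiable (at z)" "\<And>z. g differentiable (at z)"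
      by auto
    then have "(\<lambda>z. a * f z + b * g z) differentiable (at z)" for z
      by (intro derivative_intros)
    then show ?case
      using Suc by (auto simp: partial_deriv_linear[OF diff])
  qed
  then show ?thesis
    using assms by (simp add: smooth_def)
qed

lemma smooth_iterated_partial_deriv:
  "smooth g \<Longrightarrow> set es \<subseteq> Basis \<Longrightarrow> smooth (foldr partial_deriv es g)"
  by (induction es) (auto intro: smooth_partial_deriv)

lemma iterated_partial_deriv_linear:
  assumes "smooth f" "smooth g" "set es \<subseteq> Basis"
  shows "foldr partial_deriv es (\<lambda>z. a * f z + b * g z) =
    (\<lambda>z. a * foldr partial_deriv es f z + b * foldr partial_deriv es g z)"
  using assms(3)
proof (induction es)
  case (Cons e es)
  then have "smooth (foldr partial_deriv es f)" "smooth (foldr partial_deriv es g)"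
    using assms by (auto intro: smooth_iterated_partial_deriv)
  then have "partial_deriv e (\<lambda>z. a * foldr partial_deriv es f z + b * foldr partial_deriv es g z) =
      (\<lambda>z. a * partial_deriv e (foldr partial_deriv es f) z +
        b * partial_deriv e (foldr partial_deriv es g) z)"
    by (intro partial_deriv_linear) (auto simp: differentiable_def intro: smooth_has_derivative)
  then show ?case
    using Cons by simp
qed simp

lemma multi_deriv_directions_Basis:
  "set (map (\<lambda>i. (axis i 1, 0)) (index_list \<alpha>) @ map (\<lambda>j. (0, axis j 1)) (index_list \<beta>))
     \<subseteq> (Basis :: ((real ^ 'm::finite) \<times> (real ^ 'n::finite)) set)"
  by (auto simp: Basis_prod_def axis_in_Basis_iff)

lemma multi_deriv_linear:
  "smooth f \<Longrightarrow> smooth g \<Longrightarrow> multi_deriv \<alpha> \<beta> (\<lambda>z. a * f z + b * g z) =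
    (\<lambda>z. a * multi_deriv \<alpha> \<beta> f z + b * multi_deriv \<alpha> \<beta> g z)"
  unfolding multi_deriv_def
  by (rule iterated_partial_deriv_linear[OF _ _ multi_deriv_directions_Basis])

lemma lift_torus_linear:
  "lift_torus (\<lambda>z. a * f z + b * g z) = (\<lambda>z. a * lift_torus f z + b * lift_torus g z)"
  by (auto simp: lift_torus_def)

lemma schwartz_linear:
  assumes "f \<in> schwartz" "g \<in> schwartz"
  shows "(\<lambda>z. a * f z + b * g z) \<in> schwartz"
proof -
  have sm: "smooth (lift_torus f)" "smooth (lift_torus g)"
    using assms by (auto simp: schwartz_def)
  have "bdd_above (range (weighted_deriv \<alpha> \<beta> \<gamma> (\<lambda>z. a * f z + b * g z)))" for \<alpha> \<beta> \<gamma>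
  proof -
    obtain A B where A: "\<And>z. weighted_deriv \<alpha> \<beta> \<gamma> f z \<le> A" and B: "\<And>z. weighted_deriv \<alpha> \<beta> \<gamma> g z \<le> B"
      using assms unfolding schwartz_def bdd_above_def by fastforce
    have "weighted_deriv \<alpha> \<beta> \<gamma> (\<lambda>z. a * f z + b * g z) z \<le> norm a * A + norm b * B" for z
    proof -
      have "weighted_deriv \<alpha> \<beta> \<gamma> (\<lambda>z. a * f z + b * g z) z =
          norm (a * (of_real (monomial \<gamma> (snd z)) * multi_deriv \<alpha> \<beta> (lift_torus f) z) +
            b * (of_real (monomial \<gamma> (snd z)) * multi_deriv \<alpha> \<beta> (lift_torus g) z))"
        unfolding weighted_deriv_def lift_torus_linear multi_deriv_linear[OF sm]
        by (simp add: algebra_simps)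
      also have "\<dots> \<le> norm a * weighted_deriv \<alpha> \<beta> \<gamma> f z + norm b * weighted_deriv \<alpha> \<beta> \<gamma> g z"
        unfolding weighted_deriv_def norm_mult[symmetric] by (rule norm_triangle_ineq)
      also have "\<dots> \<le> norm a * A + norm b * B"
        by (intro add_mono mult_left_mono A B) auto
      finally show ?thesis .
    qed
    then show ?thesis
      by (intro bdd_aboveI[of _ "norm a * A + norm b * B"]) auto
  qed
  moreover have "smooth (lift_torus (\<lambda>z. a * f z + b * g z))"
    unfolding lift_torus_linear by (rule smooth_linear[OF sm])
  ultimately show ?thesis
    by (simp add: schwartz_def)
qed

section \<open>Decay of Schwartz functions\<close>

lemma weighted_deriv_le_schwartz_norm:
  "f \<in> schwartz \<Longrightarrow> weighted_deriv \<alpha> \<beta> \<gamma> f z \<le> schwartz_norm \<alpha> \<beta> \<gamma> f"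
  unfolding schwartz_norm_def by (rule cSUP_upper) (auto simp: schwartz_def)

lemma schwartz_norm_nonneg: "f \<in> schwartz \<Longrightarrow> 0 \<le> schwartz_norm \<alpha> \<beta> \<gamma> f"
  by (rule order_trans[OF _ weighted_deriv_le_schwartz_norm]) (auto simp: weighted_deriv_def)

lemma schwartz_seminorm_nonneg: "f \<in> schwartz \<Longrightarrow> 0 \<le> schwartz_seminorm M f"
  unfolding schwartz_seminorm_def by (auto intro!: sum_nonneg schwartz_norm_nonneg)

lemma schwartz_norm_le_seminorm:
  assumes "f \<in> schwartz" "index_order \<alpha> + index_order \<beta> + index_order \<gamma> \<le> M"
  shows "schwartz_norm \<alpha> \<beta> \<gamma> f \<le> schwartz_seminorm M f"
  unfolding schwartz_seminorm_def
  using member_le_sum[of "(\<alpha>, \<beta>, \<gamma>)"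
      "{(\<alpha>, \<beta>, \<gamma>). index_order \<alpha> + index_order \<beta> + index_order \<gamma> \<le> M}"
      "\<lambda>(\<alpha>, \<beta>, \<gamma>). schwartz_norm \<alpha> \<beta> \<gamma> f"] assms
  by (auto simp: schwartz_norm_nonneg finite_schwartz_seminorm_indices)

text \<open>
  Expanding the product of all \<open>x\<^sub>j\<^sup>2 + 1\<close> gives \<open>2 ^ CARD('n)\<close> monomials of order at most
  \<open>2 * CARD('n)\<close>, and each of them is controlled by one term of the seminorm.
\<close>

lemma schwartz_decay:
  fixes f :: "'m::finite torus \<times> (real ^ 'n::finite) \<Rightarrow> complex"
  assumes f: "f \<in> schwartz" and M: "index_order \<alpha> + index_order \<beta> + 2 * CARD('n) \<le> M"
  shows "norm (multi_deriv \<alpha> \<beta> (lift_torus f) (s, x)) \<le>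
    2 ^ CARD('n) * schwartz_seminorm M f * decay_weight x"
proof -
  let ?D = "norm (multi_deriv \<alpha> \<beta> (lift_torus f) (s, x))"
  have "(\<Prod>j\<in>S. (x $ j)\<^sup>2) * ?D \<le> schwartz_seminorm M f" for S :: "'n set"
  proof -
    \<comment> \<open>the multi-index of the squared monomial over \<open>S\<close>\<close>
    define \<gamma> where "\<gamma> j = (if j \<in> S then 2 else 0::nat)" for j
    have "monomial \<gamma> x = (\<Prod>j\<in>UNIV. if j \<in> S then (x $ j)\<^sup>2 else 1)"
      unfolding monomial_def \<gamma>_def by (intro prod.cong) auto
    also have "\<dots> = (\<Prod>j\<in>S. (x $ j)\<^sup>2)"
      by (subst prod.If_cases) auto
    finally have "(\<Prod>j\<in>S. (x $ j)\<^sup>2) * ?D = weighted_deriv \<alpha> \<beta> \<gamma> f (s, x)"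
      unfolding weighted_deriv_def norm_mult norm_of_real by (simp add: prod_nonneg)
    also have "index_order \<gamma> \<le> (\<Sum>j\<in>(UNIV::'n set). 2)"
      unfolding index_order_def by (intro sum_mono) (simp add: \<gamma>_def)
    then have "schwartz_norm \<alpha> \<beta> \<gamma> f \<le> schwartz_seminorm M f"
      using M by (intro schwartz_norm_le_seminorm f) simp
    with weighted_deriv_le_schwartz_norm[OF f, of \<alpha> \<beta> \<gamma> "(s, x)"]
    have "weighted_deriv \<alpha> \<beta> \<gamma> f (s, x) \<le> schwartz_seminorm M f"
      by linarith
    finally show ?thesis .
  qed
  then have "(\<Sum>S\<in>Pow (UNIV::'n set). (\<Prod>j\<in>S. (x $ j)\<^sup>2) * ?D) \<le>
      (\<Sum>S\<in>Pow (UNIV::'n set). schwartz_seminorm M f)"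
    by (intro sum_mono)
  moreover have "(\<Prod>j\<in>UNIV. (x $ j)\<^sup>2 + 1) = (\<Sum>S\<in>Pow UNIV. \<Prod>j\<in>S. (x $ j)\<^sup>2)"
    by (subst prod_add) auto
  ultimately have "(\<Prod>j\<in>UNIV. (x $ j)\<^sup>2 + 1) * ?D \<le> 2 ^ CARD('n) * schwartz_seminorm M f"
    by (simp add: sum_distrib_right card_Pow)
  moreover have "(\<Prod>j\<in>UNIV. (x $ j)\<^sup>2 + 1) = 1 / decay_weight x"
    unfolding decay_weight_def by (simp add: prod_dividef add.commute)
  ultimately show ?thesis
    using decay_weight_pos[of x] by (simp add: pos_divide_le_eq)
qed

lemma index_list_single: "index_list (\<lambda>i. if i = j then k else 0) = replicate k j"
proof -
  define l where "l = index_list (\<lambda>i. if i = j then k else 0)"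
  have count: "count_list l i = (if i = j then k else 0)" for i
    unfolding l_def by (rule count_index_list)
  have "i = j" if "i \<in> set l" for i
    using count[of i] that by (auto simp: count_list_0_iff split: if_splits)
  then obtain n where n: "l = replicate n j"
    using replicate_length_same[of l j] by (auto intro: sym)
  have "count_list (replicate n j) j = n"
    by (induction n) auto
  then have "n = k"
    using count[of j] n by simp
  then show ?thesis
    using n unfolding l_def by blast
qed

lemma index_list_zero: "index_list (\<lambda>_. 0) = ([] :: 'k::finite list)"
proof (rule ccontr)
  assume "index_list (\<lambda>_. 0) \<noteq> ([] :: 'k list)"
  then obtain i :: 'k where "i \<in> set (index_list (\<lambda>_. 0))"
    by (meson last_in_set)
  then have "count_list (index_list (\<lambda>_. 0)) i \<noteq> 0"
    by (simp add: count_list_0_iff)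
  then show False
    by (simp add: count_index_list)
qed

text \<open>
  The arbitrary order chosen by \<open>index_list\<close> is harmless for a multi-index supported at one
  coordinate, since there is only one list with the required counts.
\<close>

lemma multi_deriv_single:
  "multi_deriv (\<lambda>_. 0) (\<lambda>i. if i = j then k else 0) g = (partial_deriv (0, axis j 1) ^^ k) g"
  by (simp add: multi_deriv_def index_list_single index_list_zero)

lemma pure_deriv_decay:
  fixes f :: "'m::finite torus \<times> (real ^ 'n::finite) \<Rightarrow> complex"
  assumes f: "f \<in> schwartz" and M: "k + 2 * CARD('n) \<le> M"
  shows "norm ((partial_deriv (0, axis j 1) ^^ k) (lift_torus f) (s, x)) \<le>
    2 ^ CARD('n) * schwartz_seminorm M f * decay_weight x"
  using schwartz_decay[OF f, of "\<lambda>_. 0" "\<lambda>i. if i = j then k else 0" M s x] M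
  by (simp add: multi_deriv_single index_order_def)

section \<open>The partial Fourier transform of a lift\<close>

text \<open>
  The value at frequency \<open>- \<xi>\<close> of the Fourier transform in \<open>x\<close>: the sign in the exponent is that
  of the inverse transform, and it is the quantity paired with \<open>u (t, \<xi>)\<close>.
\<close>

definition fourier_slice ::
  "((real ^ 'm::finite) \<times> (real ^ 'n::finite) \<Rightarrow> complex) \<Rightarrow> real ^ 'm \<Rightarrow> real ^ 'n \<Rightarrow> complex" where
  "fourier_slice g s \<xi> = (LINT x|lborel. g (s, x) * exp (\<i> * of_real (x \<bullet> \<xi>)))"

lemma borel_measurable_slice:
  fixes g :: "'a::euclidean_space \<times> (real ^ 'n::finite) \<Rightarrow> complex"
  assumes "continuous_on UNIV g"
  shows "(\<lambda>x. g (s, x) * exp (\<i> * of_real (x \<bullet> \<xi>))) \<in> borel_measurable borel"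
proof -
  have "continuous_on UNIV (\<lambda>x. g (s, x))"
    by (rule continuous_on_compose2[OF assms]) (auto intro!: continuous_intros)
  then show ?thesis
    by (intro borel_measurable_continuous_onI continuous_intros)
qed

lemma integrable_slice:
  fixes g :: "'a::euclidean_space \<times> (real ^ 'n::finite) \<Rightarrow> complex"
  assumes "continuous_on UNIV g" "\<And>x. norm (g (s, x)) \<le> B * decay_weight x"
  shows "integrable lborel (\<lambda>x. g (s, x) * exp (\<i> * of_real (x \<bullet> \<xi>)))"
proof (rule Bochner_Integration.integrable_bound)
  show "integrable lborel (\<lambda>x. B * decay_weight (x :: real ^ 'n))"
    by (simp add: integrable_decay_weight)
  show "AE x in lborel. norm (g (s, x) * exp (\<i> * of_real (x \<bullet> \<xi>))) \<le> norm (B * decay_weight x)"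
    using assms(2) by (auto simp: norm_mult intro: order_trans[OF _ abs_ge_self])
qed (use borel_measurable_slice[OF assms(1)] in simp)

lemma norm_fourier_slice_le:
  fixes g :: "(real ^ 'm::finite) \<times> (real ^ 'n::finite) \<Rightarrow> complex"
  assumes "continuous_on UNIV g" "\<And>x. norm (g (s, x)) \<le> B * decay_weight x"
  shows "norm (fourier_slice g s \<xi>) \<le> B * (LINT x|lborel. decay_weight (x :: real ^ 'n))"
proof -
  have "norm (fourier_slice g s \<xi>) \<le> (LINT x|lborel. B * decay_weight (x :: real ^ 'n))"
    unfolding fourier_slice_def
  proof (rule Bochner_Integration.integral_norm_bound_integral[OF integrable_slice[OF assms]])
    show "integrable lborel (\<lambda>x. B * decay_weight (x :: real ^ 'n))"
      by (simp add: integrable_decay_weight)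
  qed (use assms(2) in \<open>simp add: norm_mult\<close>)
  then show ?thesis by simp
qed

lemma borel_measurable_fourier_slice:
  assumes g: "continuous_on UNIV (g :: (real ^ 'm::finite) \<times> (real ^ 'n::finite) \<Rightarrow> complex)"
  shows "(\<lambda>z. fourier_slice g (fst z) (snd z)) \<in> borel_measurable borel"
proof -
  let ?k = "\<lambda>(z :: (real ^ 'm) \<times> (real ^ 'n)) x. g (fst z, x) * exp (\<i> * of_real (x \<bullet> snd z))"
  have "continuous_on UNIV (\<lambda>p :: ((real ^ 'm) \<times> (real ^ 'n)) \<times> (real ^ 'n). g (fst (fst p), snd p))"
    by (rule continuous_on_compose2[OF g]) (auto intro!: continuous_intros)
  then have "continuous_on UNIV (case_prod ?k)"
    unfolding case_prod_beta by (intro continuous_intros)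
  then have "case_prod ?k \<in> borel_measurable (borel \<Otimes>\<^sub>M borel)"
    unfolding borel_prod by (rule borel_measurable_continuous_onI)
  then have "case_prod ?k \<in> borel_measurable (borel \<Otimes>\<^sub>M lborel)"
    by (simp cong: measurable_cong_sets sets_pair_measure_cong)
  then show ?thesis
    unfolding fourier_slice_def by (rule lborel.borel_measurable_lebesgue_integral)
qed

text \<open>
  Integration by parts: the derivative of \<open>g (s, x) * exp (\<i> * (x \<bullet> \<xi>))\<close> in the direction of the
  \<open>j\<close>-th axis integrates to zero.
\<close>

lemma fourier_slice_partial_deriv:
  fixes g :: "(real ^ 'm::finite) \<times> (real ^ 'n::finite) \<Rightarrow> complex"
  assumes g: "smooth g"
    and bound: "\<And>x. norm (g (s, x)) \<le> B * decay_weight x"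
    and bound': "\<And>x. norm (partial_deriv (0, axis j 1) g (s, x)) \<le> B * decay_weight x"
  shows "fourier_slice (partial_deriv (0, axis j 1) g) s \<xi> =
    - \<i> * of_real (\<xi> $ j) * fourier_slice g s \<xi>"
proof -
  define e :: "real ^ 'n" where "e = axis j 1"
  define E where "E x = exp (\<i> * of_real (x \<bullet> \<xi>))" for x :: "real ^ 'n"
  define F where "F x = g (s, x) * E x" for x
  define F' where "F' x h = g (s, x) * (E x * (\<i> * of_real (h \<bullet> \<xi>))) +
      frechet_derivative g (at (s, x)) (0, h) * E x" for x h
  have F'_e: "F' x e = (\<i> * of_real (\<xi> $ j)) * (g (s, x) * E x) + partial_deriv (0, e) g (s, x) * E x" for x
    unfolding F'_def partial_deriv_def e_def by (simp add: inner_axis inner_commute)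
  have smooth': "smooth (partial_deriv (0, e) g)"
    using g unfolding e_def by (rule smooth_partial_deriv) (auto simp: Basis_prod_def axis_in_Basis_iff)
  have int: "integrable lborel (\<lambda>x. g (s, x) * E x)"
      "integrable lborel (\<lambda>x. partial_deriv (0, e) g (s, x) * E x)"
    unfolding E_def
    using integrable_slice[OF smooth_continuous_on[OF g] bound]
      integrable_slice[OF smooth_continuous_on[OF smooth'] bound'[folded e_def]] by auto
  have "(LINT x|lborel. F' x e) = 0"
  proof (rule integral_directional_derivative_eq_0)
    show "(F has_derivative F' x) (at x)" for x
    proof -
      have "((\<lambda>x. g (s, x)) has_derivative (\<lambda>h. frechet_derivative g (at (s, x)) (0, h))) (at x)"
        by (rule has_derivative_compose[OF _ smooth_has_derivative[OF g]])
           (auto intro!: derivative_eq_intros)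
      moreover have "(E has_derivative (\<lambda>h. E x * (\<i> * of_real (h \<bullet> \<xi>)))) (at x)"
        unfolding E_def
        by (rule has_derivative_compose[of _ _ _ UNIV exp])
           (auto intro!: derivative_eq_intros DERIV_exp[unfolded has_field_derivative_def])
      ultimately show ?thesis
        unfolding F_def F'_def by (rule has_derivative_mult)
    qed
    show "integrable lborel F"
      unfolding F_def by (rule int)
    show "norm (F' x e) \<le> (\<bar>\<xi> $ j\<bar> * B + B) * decay_weight x" for x
    proof -
      have "norm (F' x e) \<le> \<bar>\<xi> $ j\<bar> * norm (g (s, x)) + norm (partial_deriv (0, e) g (s, x))"
        unfolding F'_e by (rule order_trans[OF norm_triangle_ineq]) (simp add: norm_mult E_def)
      also have "\<dots> \<le> \<bar>\<xi> $ j\<bar> * (B * decay_weight x) + B * decay_weight x"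
        by (intro add_mono mult_left_mono bound bound'[folded e_def]) auto
      finally show ?thesis
        by (simp add: algebra_simps)
    qed
    show "norm e \<le> 1"
      by (simp add: e_def)
  qed
  also have "(LINT x|lborel. F' x e) =
      (\<i> * of_real (\<xi> $ j)) * (LINT x|lborel. g (s, x) * E x) + (LINT x|lborel. partial_deriv (0, e) g (s, x) * E x)"
    unfolding F'_e by (simp only: Bochner_Integration.integral_add[OF integrable_mult_right[OF int(1)] int(2)] integral_mult_right_zero)
  finally show ?thesis
    unfolding fourier_slice_def E_def e_def by (simp add: eq_neg_iff_add_eq_0 add.commute)
qed

lemma smooth_iterated_pure_deriv:
  fixes g :: "(real ^ 'm::finite) \<times> (real ^ 'n::finite) \<Rightarrow> complex"
  shows "smooth g \<Longrightarrow> smooth ((partial_deriv (0, axis j 1) ^^ k) g)"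
  by (induction k) (auto intro!: smooth_partial_deriv simp: Basis_prod_def axis_in_Basis_iff)

lemma fourier_slice_pure_deriv:
  fixes f :: "'m::finite torus \<times> (real ^ 'n::finite) \<Rightarrow> complex"
  assumes f: "f \<in> schwartz"
  shows "fourier_slice ((partial_deriv (0, axis j 1) ^^ k) (lift_torus f)) s \<xi> =
    (- \<i> * of_real (\<xi> $ j)) ^ k * fourier_slice (lift_torus f) s \<xi>"
proof (induction k)
  case (Suc k)
  let ?g = "(partial_deriv (0, axis j 1) ^^ k) (lift_torus f)"
  have "fourier_slice (partial_deriv (0, axis j 1) ?g) s \<xi> =
      - \<i> * of_real (\<xi> $ j) * fourier_slice ?g s \<xi>"
  proof (rule fourier_slice_partial_deriv)
    let ?B = "2 ^ CARD('n) * schwartz_seminorm (Suc k + 2 * CARD('n)) f"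
    show "smooth ?g"
      using f by (intro smooth_iterated_pure_deriv) (simp add: schwartz_def)
    show "norm (?g (s, x)) \<le> ?B * decay_weight x" for x
      by (rule pure_deriv_decay[OF f]) simp
    show "norm (partial_deriv (0, axis j 1) ?g (s, x)) \<le> ?B * decay_weight x" for x
      using pure_deriv_decay[OF f, of "Suc k" "Suc k + 2 * CARD('n)" j s x] by simp
  qed
  then show ?case
    by (simp add: Suc.IH)
qed simp

text \<open>
  The mean of the \<open>card A + 1\<close> numbers \<open>1\<close> and \<open>a j\<close> is at most one of them, so its \<open>L\<close>-th power is
  at most the sum of all \<open>L\<close>-th powers.
\<close>

lemma power_one_plus_sum_le:
  fixes a :: "'a \<Rightarrow> real"
  assumes "finite A" "\<And>j. j \<in> A \<Longrightarrow> 0 \<le> a j"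
  shows "(1 + (\<Sum>j\<in>A. a j)) ^ L \<le> (1 + real (card A)) ^ L * (1 + (\<Sum>j\<in>A. a j ^ L))"
proof -
  let ?c = "1 + real (card A)"
  define b where "b = (1 + (\<Sum>j\<in>A. a j)) / ?c"
  have b: "b \<ge> 0" "1 + (\<Sum>j\<in>A. a j) = ?c * b"
    using assms by (auto simp: b_def sum_nonneg intro!: divide_nonneg_pos add_nonneg_nonneg)
  have "b \<le> 1 \<or> (\<exists>j\<in>A. b \<le> a j)"
  proof (rule ccontr)
    assume "\<not> ?thesis"
    then have "b > 1" "(\<Sum>j\<in>A. a j) \<le> real (card A) * b"
      using sum_bounded_above[of A a b] by (auto simp: not_le less_imp_le)
    then show False
      using b(2) by (simp add: algebra_simps)
  qed
  then have "b ^ L \<le> 1 + (\<Sum>j\<in>A. a j ^ L)"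
  proof
    assume "b \<le> 1"
    then have "b ^ L \<le> 1"
      using b(1) by (simp add: power_le_one)
    moreover have "0 \<le> (\<Sum>j\<in>A. a j ^ L)"
      using assms by (simp add: sum_nonneg)
    ultimately show ?thesis by linarith
  next
    assume "\<exists>j\<in>A. b \<le> a j"
    then obtain j where "j \<in> A" "b \<le> a j" by blast
    then have "b ^ L \<le> a j ^ L" "a j ^ L \<le> (\<Sum>j\<in>A. a j ^ L)"
      using b(1) assms by (auto intro!: power_mono member_le_sum)
    then show ?thesis by linarith
  qed
  then show ?thesis
    unfolding b(2) power_mult_distrib by (intro mult_left_mono) auto
qed

text \<open>
  For \<open>a = 1 + |\<xi>|\<^sup>2\<close> the reciprocal of the weight is at most \<open>a ^ CARD('n)\<close>, so it suffices to bound
  \<open>a ^ L\<close> times the transform for an integer \<open>L \<ge> r + CARD('n)\<close>. This power is controlled by \<open>1\<close> and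
  the powers \<open>\<xi>\<^sub>j ^ (2 * L)\<close>, that is, by the transforms of \<open>f\<close> and of its pure derivatives of
  order \<open>2 * L\<close>; the remaining \<open>2 * CARD('n)\<close> orders in \<open>M\<close> pay for convergence of the integrals
  over \<open>x\<close>.
\<close>

lemma fourier_slice_decay:
  fixes r :: real
  obtains M :: nat and K :: real where "M > 0" "K > 0"
    "\<And>(f :: 'm::finite torus \<times> (real ^ 'n::finite) \<Rightarrow> complex) s \<xi>. f \<in> schwartz \<Longrightarrow>
      (1 + (norm \<xi>)\<^sup>2) powr r * norm (fourier_slice (lift_torus f) s \<xi>) \<le>
        K * schwartz_seminorm M f * decay_weight \<xi>"
proof -
  define n where "n = CARD('n)"
  define L where "L = nat \<lceil>r\<rceil> + n"
  define M where "M = 2 * L + 2 * n"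
  define W where "W = (LINT x|lborel. decay_weight (x :: real ^ 'n))"
  define K where "K = (1 + real n) ^ L * (1 + real n) * 2 ^ n * W"
  have n: "n > 0"
    by (simp add: n_def)
  have W: "W \<ge> 0"
    unfolding W_def by (intro Bochner_Integration.integral_nonneg) (simp add: decay_weight_pos less_imp_le)
  then have K: "K \<ge> 0"
    by (simp add: K_def)
  have "(1 + (norm \<xi>)\<^sup>2) powr r * norm (fourier_slice (lift_torus f) s \<xi>) \<le>
        (K + 1) * schwartz_seminorm M f * decay_weight \<xi>"
    if f: "f \<in> schwartz" for f :: "'m torus \<times> (real ^ 'n) \<Rightarrow> complex" and s \<xi>
  proof -
    define p where "p = schwartz_seminorm M f"
    define \<Phi> where "\<Phi> = norm (fourier_slice (lift_torus f) s \<xi>)"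
    define a where "a = 1 + (norm \<xi>)\<^sup>2"
    have p: "p \<ge> 0"
      unfolding p_def by (rule schwartz_seminorm_nonneg[OF f])
    have a: "a \<ge> 1" "a = 1 + (\<Sum>j\<in>UNIV. (\<xi> $ j)\<^sup>2)"
      by (simp_all add: a_def norm_vec_def L2_set_def sum_nonneg)
    have pure: "\<bar>\<xi> $ j\<bar> ^ k * \<Phi> \<le> 2 ^ n * p * W" if "k \<le> 2 * L" for j k
    proof -
      let ?g = "(partial_deriv (0, axis j 1) ^^ k) (lift_torus f)"
      have "\<bar>\<xi> $ j\<bar> ^ k * \<Phi> = norm (fourier_slice ?g s \<xi>)"
        unfolding fourier_slice_pure_deriv[OF f] \<Phi>_def by (simp add: norm_mult norm_power)
      also have "\<dots> \<le> 2 ^ n * p * W"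
        unfolding W_def
      proof (rule norm_fourier_slice_le)
        show "continuous_on UNIV ?g"
          using f by (intro smooth_continuous_on smooth_iterated_pure_deriv) (simp add: schwartz_def)
        show "norm (?g (s, x)) \<le> 2 ^ n * p * decay_weight x" for x
          unfolding p_def n_def using that by (intro pure_deriv_decay f) (simp add: M_def n_def)
      qed
      finally show ?thesis .
    qed
    have "a powr r * \<Phi> / decay_weight \<xi> \<le> a ^ L * \<Phi>"
    proof -
      have "1 / decay_weight \<xi> = (\<Prod>j\<in>UNIV. 1 + (\<xi> $ j)\<^sup>2)"
        by (simp add: decay_weight_def prod_dividef)
      also have "\<dots> \<le> (\<Prod>j\<in>(UNIV::'n set). a)"
        unfolding a(2) by (intro prod_mono conjI add_left_mono member_le_sum) auto
      also have "\<dots> = a ^ n"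
        by (simp add: n_def)
      finally have "1 / decay_weight \<xi> \<le> a ^ n" .
      moreover have "a powr r \<le> a ^ nat \<lceil>r\<rceil>"
        using powr_mono[of r "real (nat \<lceil>r\<rceil>)" a] a(1) by (simp add: powr_realpow real_nat_ceiling_ge)
      ultimately have "a powr r * (1 / decay_weight \<xi>) \<le> a ^ nat \<lceil>r\<rceil> * a ^ n"
        using decay_weight_pos[of \<xi>] a(1) by (intro mult_mono) auto
      then have "(a powr r * (1 / decay_weight \<xi>)) * \<Phi> \<le> a ^ L * \<Phi>"
        unfolding L_def power_add by (intro mult_right_mono) (simp_all add: \<Phi>_def)
      then show ?thesis by simp
    qed
    also have "a ^ L * \<Phi> \<le> ((1 + real n) ^ L * (1 + (\<Sum>j\<in>UNIV. ((\<xi> $ j)\<^sup>2) ^ L))) * \<Phi>"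
      unfolding a(2) n_def by (intro mult_right_mono power_one_plus_sum_le) (auto simp: \<Phi>_def)
    also have "\<dots> = (1 + real n) ^ L * (\<Phi> + (\<Sum>j\<in>UNIV. \<bar>\<xi> $ j\<bar> ^ (2 * L) * \<Phi>))"
    proof -
      have "((\<xi> $ j)\<^sup>2) ^ L = \<bar>\<xi> $ j\<bar> ^ (2 * L)" for j
        by (simp only: power_mult power2_abs)
      then show ?thesis
        by (simp add: algebra_simps sum_distrib_left)
    qed
    also have "\<dots> \<le> (1 + real n) ^ L * (2 ^ n * p * W + (\<Sum>j\<in>(UNIV::'n set). 2 ^ n * p * W))"
      using pure[of 0] pure[of "2 * L"] by (intro mult_left_mono add_mono sum_mono) auto
    also have "\<dots> = K * p"
      by (simp add: K_def n_def algebra_simps)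
    also have "\<dots> \<le> (K + 1) * p"
      using p by (intro mult_right_mono) auto
    finally show ?thesis
      using decay_weight_pos[of \<xi>] by (simp add: pos_divide_le_eq a_def \<Phi>_def p_def)
  qed
  \<comment> \<open>\<open>K\<close> is only known to be nonnegative, hence the constant \<open>K + 1\<close>\<close>
  then show thesis
    using n K by (intro that[of M "K + 1"]) (auto simp: M_def)
qed

section \<open>The inverse partial Fourier transform as a tempered functional\<close>

lemma to_torus_surj: obtains s where "to_torus s = t"
proof
  show "to_torus (\<chi> i. rep_circle (t $ i)) = t"
    by (simp add: to_torus_def vec_eq_iff Quotient_abs_rep[OF Quotient_circle])
qed

lemma schwartz_slice_decay:
  fixes f :: "'m::finite torus \<times> (real ^ 'n::finite) \<Rightarrow> complex"
  assumes f: "f \<in> schwartz"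
  shows "continuous_on UNIV (lift_torus f)"
    and "norm (lift_torus f (s, x)) \<le>
      2 ^ CARD('n) * schwartz_seminorm (2 * CARD('n)) f * decay_weight x"
  using f pure_deriv_decay[OF f, of 0 "2 * CARD('n)"]
  by (auto simp: schwartz_def intro: smooth_continuous_on)

lemma integrable_schwartz_slice:
  fixes f :: "'m::finite torus \<times> (real ^ 'n::finite) \<Rightarrow> complex"
  assumes f: "f \<in> schwartz"
  shows "integrable lborel (\<lambda>x. lift_torus f (s, x) * exp (\<i> * of_real (x \<bullet> \<xi>)))"
  by (rule integrable_slice[OF schwartz_slice_decay[OF f]])

lemma partial_fourier_eq_fourier_slice:
  assumes f: "f \<in> schwartz"
  shows "partial_fourier f (to_torus s, - \<xi>) = fourier_slice (lift_torus f) s \<xi>"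
proof -
  have "partial_fourier f (to_torus s, - \<xi>) =
      (LINT x|lebesgue. lift_torus f (s, x) * exp (\<i> * of_real (x \<bullet> \<xi>)))"
    by (simp add: partial_fourier_def lift_torus_def)
  also have "\<dots> = fourier_slice (lift_torus f) s \<xi>"
    unfolding fourier_slice_def
    using borel_measurable_slice[OF schwartz_slice_decay(1)[OF f]]
    by (intro integral_completion) simp
  finally show ?thesis .
qed

lemma fourier_slice_linear:
  assumes f: "f \<in> schwartz" and g: "g \<in> schwartz"
  shows "fourier_slice (lift_torus (\<lambda>z. a * f z + b * g z)) s \<xi> =
    a * fourier_slice (lift_torus f) s \<xi> + b * fourier_slice (lift_torus g) s \<xi>"
  unfolding fourier_slice_def lift_torus_linear
  using integrable_schwartz_slice[OF f, of s \<xi>] integrable_schwartz_slice[OF g, of s \<xi>]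
  by (simp add: distrib_right mult.assoc)

lemma integrable_cylinder:
  fixes w :: "'b::euclidean_space \<Rightarrow> real"
  assumes A: "A \<in> sets borel" "emeasure lborel A < \<infinity>" and w: "integrable lborel w"
  shows "integrable lborel (\<lambda>z :: 'a::euclidean_space \<times> 'b. indicator A (fst z) * w (snd z))"
proof -
  have [measurable]: "w \<in> borel_measurable borel" "A \<in> sets borel"
    using w A by auto
  have "integrable (lborel \<Otimes>\<^sub>M lborel) (\<lambda>z :: 'a \<times> 'b. indicator A (fst z) * w (snd z))"
  proof (rule lborel_pair.Fubini_integrable)
    show "(\<lambda>z :: 'a \<times> 'b. indicator A (fst z) * w (snd z)) \<in> borel_measurable (lborel \<Otimes>\<^sub>M lborel)"
      by measurable
    show "integrable lborel (\<lambda>x::'a. LINT y|lborel. norm (indicator A (fst (x, y)) * w (snd (x, y))))"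
      using A by (simp add: abs_mult)
    show "AE x::'a in lborel. integrable lborel (\<lambda>y. indicator A (fst (x, y)) * w (snd (x, y)))"
      using w by simp
  qed
  then show ?thesis
    by (simp add: lborel_prod)
qed

theorem proposition2p6:
  fixes u :: "'m::finite torus \<times> (real ^ 'n::finite) \<Rightarrow> complex"
    and C N :: real
  assumes "lift_torus u \<in> borel_measurable lebesgue"
    and "C > 0" and "N > 0"
    and "\<forall>t \<xi>. norm (u (t, \<xi>)) \<le> C * (1 + (norm \<xi>)\<^sup>2) powr (N / 2)"
  shows "(\<forall>f\<in>schwartz.
            (\<forall>t \<xi>. integrable lebesgue (\<lambda>x. u (t, \<xi>) * exp (\<i> * of_real (x \<bullet> \<xi>)) * f (t, x))) \<and>
            set_integrable lebesgue (fundamental_cube \<times> UNIV)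
              (lift_torus (\<lambda>(t, \<xi>). u (t, \<xi>) * partial_fourier f (t, - \<xi>)))) \<and>
         (\<exists>!v. v \<in> schwartz_dual \<and>
            (\<forall>f\<in>schwartz.
               v f = 1 / (2 * of_real pi) ^ CARD('n) *
                 torus_integral (\<lambda>t. LINT \<xi>|lebesgue. LINT x|lebesgue.
                   u (t, \<xi>) * exp (\<i> * of_real (x \<bullet> \<xi>)) * f (t, x)) \<and>
               v f = 1 / (2 * of_real pi) ^ CARD('n) *
                 torus_integral (\<lambda>t. LINT \<xi>|lebesgue. u (t, \<xi>) * partial_fourier f (t, - \<xi>))))"
proof -
  define c :: complex where "c = 1 / (2 * of_real pi) ^ CARD('n)"
  define Q :: "((real ^ 'm) \<times> (real ^ 'n)) set" where "Q = fundamental_cube \<times> UNIV"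
  define h where "h f = lift_torus (\<lambda>(t, \<xi>). u (t, \<xi>) * partial_fourier f (t, - \<xi>))" for f
  define I where "I f = c * (LINT z:Q|lebesgue. h f z)" for f
  obtain M K where "M > 0" "K > 0"
    and decay: "\<And>(f :: 'm torus \<times> (real ^ 'n) \<Rightarrow> complex) s \<xi>. f \<in> schwartz \<Longrightarrow>
      (1 + (norm \<xi>)\<^sup>2) powr (N / 2) * norm (fourier_slice (lift_torus f) s \<xi>) \<le>
        K * schwartz_seminorm M f * decay_weight \<xi>"
    using fourier_slice_decay by blast
  \<comment> \<open>integrable majorant of the integrand, up to the seminorm of \<open>f\<close>\<close>
  define \<phi> where "\<phi> z = indicator fundamental_cube (fst z) * decay_weight (snd z)"
    for z :: "(real ^ 'm) \<times> (real ^ 'n)"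
  have cube: "fundamental_cube \<in> sets (borel :: (real ^ 'm) measure)"
    "emeasure lborel (fundamental_cube :: (real ^ 'm) set) < \<infinity>"
    unfolding fundamental_cube_def by (simp, rule emeasure_lborel_cbox_finite)
  have \<phi>: "integrable lborel \<phi>"
    unfolding \<phi>_def by (rule integrable_cylinder[OF cube integrable_decay_weight])
  then have \<phi>': "integrable lebesgue \<phi>"
    by (simp add: integrable_completion)
  have Q: "Q \<in> sets lebesgue"
    using cube(1) unfolding Q_def borel_prod[symmetric] by (intro sets_completionI_sets) (simp add: borel_Times)

  have h_eq: "h f z = lift_torus u z * fourier_slice (lift_torus f) (fst z) (snd z)"
    if "f \<in> schwartz" for f z
    using partial_fourier_eq_fourier_slice[OF that]
    by (cases z) (simp add: h_def lift_torus_def)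
  have h_bound: "norm (indicator Q z *\<^sub>R h f z) \<le> C * K * schwartz_seminorm M f * \<phi> z"
    if f: "f \<in> schwartz" for f z
  proof -
    obtain s \<xi> where z: "z = (s, \<xi>)" by (cases z)
    let ?\<Phi> = "norm (fourier_slice (lift_torus f) s \<xi>)"
    have "norm (h f z) = norm (u (to_torus s, \<xi>)) * ?\<Phi>"
      unfolding h_eq[OF f] by (simp add: z norm_mult lift_torus_def)
    also have "\<dots> \<le> C * (1 + (norm \<xi>)\<^sup>2) powr (N / 2) * ?\<Phi>"
      using assms(4) by (intro mult_right_mono) auto
    also have "\<dots> \<le> C * (K * schwartz_seminorm M f * decay_weight \<xi>)"
      using decay[OF f, of \<xi> s] \<open>C > 0\<close> by (simp add: mult.assoc)
    finally show ?thesis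
      by (auto simp: z Q_def \<phi>_def mult.assoc split: split_indicator)
  qed
  have h_int: "set_integrable lebesgue Q (h f)" if f: "f \<in> schwartz" for f
    unfolding set_integrable_def
  proof (rule Bochner_Integration.integrable_bound)
    show "integrable lebesgue (\<lambda>z. C * K * schwartz_seminorm M f * \<phi> z)"
      using \<phi>' by simp
    have "(\<lambda>z. fourier_slice (lift_torus f) (fst z) (snd z)) \<in> borel_measurable lebesgue"
      using borel_measurable_fourier_slice[OF schwartz_slice_decay(1)[OF f]]
      by (intro measurable_completion) simp
    then have "h f \<in> borel_measurable lebesgue"
      using assms(1) unfolding h_eq[OF f, abs_def] by (rule borel_measurable_times[rotated])
    then show "(\<lambda>z. indicator Q z *\<^sub>R h f z) \<in> borel_measurable lebesgue"
      using Q by (intro borel_measurable_scaleR borel_measurable_indicator)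
    show "AE z in lebesgue. norm (indicator Q z *\<^sub>R h f z) \<le> norm (C * K * schwartz_seminorm M f * \<phi> z)"
      by (intro always_eventually allI order_trans[OF h_bound[OF f]])
         (simp only: real_norm_def abs_ge_self)
  qed
  have inner_int: "integrable lebesgue (\<lambda>x. u (t, \<xi>) * exp (\<i> * of_real (x \<bullet> \<xi>)) * f (t, x))"
    if f: "f \<in> schwartz" for f t \<xi>
  proof -
    obtain s where t: "to_torus s = t" by (rule to_torus_surj)
    have "integrable lebesgue (\<lambda>x. lift_torus f (s, x) * exp (\<i> * of_real (x \<bullet> \<xi>)))"
      using integrable_schwartz_slice[OF f] borel_measurable_slice[OF schwartz_slice_decay(1)[OF f]]
      by (simp add: integrable_completion)
    then have "integrable lebesgue (\<lambda>x. u (t, \<xi>) * (lift_torus f (s, x) * exp (\<i> * of_real (x \<bullet> \<xi>))))"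
      by simp
    then show ?thesis
      by (simp add: lift_torus_def t mult_ac)
  qed
  have inner_eq: "(LINT x|lebesgue. u (t, \<xi>) * exp (\<i> * of_real (x \<bullet> \<xi>)) * f (t, x)) =
      u (t, \<xi>) * partial_fourier f (t, - \<xi>)" for f t \<xi>
    unfolding partial_fourier_def by (simp add: mult_ac flip: integral_mult_right_zero)
  have I_eq: "I f = c * torus_integral (\<lambda>t. LINT \<xi>|lebesgue. u (t, \<xi>) * partial_fourier f (t, - \<xi>))"
    if f: "f \<in> schwartz" for f
  proof -
    have "(LINT z:Q|lebesgue. h f z) =
        (LINT s|lebesgue. LINT \<xi>|lebesgue. indicator Q (s, \<xi>) *\<^sub>R h f (s, \<xi>))"
      unfolding set_lebesgue_integral_def
      using lebesgue_Fubini[OF h_int[OF f, unfolded set_integrable_def]] by simp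
    also have "\<dots> = (LINT s|lebesgue. indicator fundamental_cube s *\<^sub>R (LINT \<xi>|lebesgue. h f (s, \<xi>)))"
      by (intro Bochner_Integration.integral_cong refl) (simp add: Q_def indicator_times)
    also have "\<dots> = torus_integral (\<lambda>t. LINT \<xi>|lebesgue. u (t, \<xi>) * partial_fourier f (t, - \<xi>))"
      by (simp add: torus_integral_def set_lebesgue_integral_def h_def lift_torus_def)
    finally show ?thesis
      by (simp add: I_def)
  qed
  \<comment> \<open>on the product the integrals of \<open>h f\<close> and \<open>h g\<close> both converge, so they can be added; for the
    iterated integrals this is available for almost every \<open>t\<close> only\<close>
  have I_linear: "I (\<lambda>z. a * f z + b * g z) = a * I f + b * I g"
    if f: "f \<in> schwartz" and g: "g \<in> schwartz" for a b f g
  proof -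
    have "h (\<lambda>z. a * f z + b * g z) z = a * h f z + b * h g z" for z
      unfolding h_eq[OF f] h_eq[OF g] h_eq[OF schwartz_linear[OF f g]] fourier_slice_linear[OF f g]
      by (simp add: algebra_simps)
    then have "(LINT z:Q|lebesgue. h (\<lambda>z. a * f z + b * g z) z) =
        (LINT z:Q|lebesgue. a * h f z + b * h g z)"
      by simp
    also have "\<dots> = a * (LINT z:Q|lebesgue. h f z) + b * (LINT z:Q|lebesgue. h g z)"
      using h_int[OF f] h_int[OF g] by (simp add: set_integral_add set_integrable_mult_right)
    finally show ?thesis
      by (simp add: I_def algebra_simps)
  qed
  have I_bound: "norm (I f) \<le> (norm c * (C * K * (LINT z|lebesgue. \<phi> z))) * schwartz_seminorm M f"
    if f: "f \<in> schwartz" for f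
  proof -
    have "norm (LINT z:Q|lebesgue. h f z) \<le> (LINT z|lebesgue. C * K * schwartz_seminorm M f * \<phi> z)"
      unfolding set_lebesgue_integral_def
      using h_int[OF f, unfolded set_integrable_def] \<phi>' h_bound[OF f]
      by (intro Bochner_Integration.integral_norm_bound_integral) auto
    then have "norm c * norm (LINT z:Q|lebesgue. h f z) \<le>
        norm c * (C * K * schwartz_seminorm M f * (LINT z|lebesgue. \<phi> z))"
      by (intro mult_left_mono) simp_all
    then show ?thesis
      by (simp add: I_def norm_mult mult_ac)
  qed

  let ?v = "restrict I schwartz"
  have dual: "?v \<in> schwartz_dual"
  proof -
    have "?v (\<lambda>z. f z + g z) = ?v f + ?v g" if "f \<in> schwartz" "g \<in> schwartz" for f g
      using I_linear[OF that, of 1 1] schwartz_linear[OF that, of 1 1] that by simp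
    moreover have "?v (\<lambda>z. a * f z) = a * ?v f" if "f \<in> schwartz" for a f
      using I_linear[OF that that, of a 0] schwartz_linear[OF that that, of a 0] that by simp
    moreover have "\<exists>M::nat. \<exists>K::real. M > 0 \<and> K > 0 \<and>
        (\<forall>f\<in>schwartz. norm (?v f) \<le> K * schwartz_seminorm M f)"
    proof (intro exI conjI ballI)
      let ?K = "norm c * (C * K * (LINT z|lebesgue. \<phi> z))"
      have "(LINT z|lebesgue. \<phi> z) \<ge> 0"
        by (intro Bochner_Integration.integral_nonneg)
           (simp add: \<phi>_def decay_weight_pos less_imp_le)
      then show "?K + 1 > 0"
        using \<open>C > 0\<close> \<open>K > 0\<close> by (intro add_nonneg_pos mult_nonneg_nonneg) auto
      \<comment> \<open>adding 1 makes the constant positive without knowing that \<open>\<phi>\<close> has positive integral\<close>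
      show "norm (?v f) \<le> (?K + 1) * schwartz_seminorm M f" if f: "f \<in> schwartz" for f
        using I_bound[OF f] schwartz_seminorm_nonneg[OF f, of M] f by (simp add: algebra_simps)
    qed (rule \<open>M > 0\<close>)
    ultimately show ?thesis
      by (simp add: schwartz_dual_def)
  qed
  show ?thesis
    unfolding inner_eq c_def[symmetric]
  proof (intro conjI ballI allI ex1I[of _ ?v])
    show "w = ?v" if "w \<in> schwartz_dual \<and> (\<forall>f\<in>schwartz.
        w f = c * torus_integral (\<lambda>t. LINT \<xi>|lebesgue. u (t, \<xi>) * partial_fourier f (t, - \<xi>)) \<and>
        w f = c * torus_integral (\<lambda>t. LINT \<xi>|lebesgue. u (t, \<xi>) * partial_fourier f (t, - \<xi>)))" for w
    proof (rule extensionalityI[of _ schwartz])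
      show "w \<in> extensional schwartz" "?v \<in> extensional schwartz"
        using that by (auto simp: schwartz_dual_def)
    qed (use that in \<open>simp add: I_eq\<close>)
  qed (use inner_int h_int dual in \<open>simp_all add: I_eq Q_def h_def\<close>)
qed

end
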